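(* Let $q,x_1,\ldots,x_n\in\mathbb{R}^d$, let $k\ge1$, and let $S$ be any subset of $\{x_1,\ldots,x_n\}$ containing $x_{(1)},\ldots,x_{(k)}$. Suppose $q$ and the points of $S$ are projected onto a direction $U$ chosen uniformly at random from the unit sphere $S^{d-1}$. Let $0<\alpha<1$ with $k<\alpha|S|+1$. Then the probability (over $U$) that there exists $1\le j\le k$ such that at least $\alpha|S|$ points of $S$ project strictly between $x_{(j)}\cdot U$ and $q\cdot U$ is at most $$\frac{k}{2(\alpha-(k-1)/|S|)}\,\Phi_{k,|S|}(q,\{x_1,\ldots,x_n\}).$$
   Context: $x_{(1)},\ldots,x_{(n)}$ is an ordering of $x_1,\ldots,x_n$ by increasing Euclidean distance from $q$. For $m\le n$, $$\Phi_{k,m}(q,\{x_1,\ldots,x_n\})=\frac1m\sum_{i=k+1}^m\frac{(\|q-x_{(1)}\|+\cdots+\|q-x_{(k)}\|)/k}{\|q-x_{(i)}\|}.$$ *)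

theory Defs
  imports "HOL-Probability.Probability"
begin

text \<open>
  The uniform distribution on the unit sphere, as a Borel measure on the ambient space: the radial
  projection of the uniform distribution on the unit ball. So a set \<open>A\<close> of directions has mass
  proportional to the volume of the cone \<open>{t u. u \<in> A, 0 < t < 1}\<close>, which is the normalised surface
  measure; in dimension one it gives mass \<open>1/2\<close> to each of the two points of the sphere.
\<close>

definition uniform_sphere :: "'a::euclidean_space measure" where
  "uniform_sphere = distr (uniform_measure lborel (ball 0 1)) borel sgn"

lemma space_uniform_sphere [simp]: "space uniform_sphere = UNIV"
  by (simp add: uniform_sphere_def)

lemma sets_uniform_sphere [simp, measurable_cong]: "sets uniform_sphere = sets borel"
  by (simp add: uniform_sphere_def)

lemma emeasure_unit_ball_pos_finite:
  "emeasure lborel (ball (0 :: 'a::euclidean_space) 1) \<noteq> 0" "emeasure lborel (ball (0 :: 'a) 1) \<noteq> \<infinity>"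
  using content_ball_pos[of 1 "0 :: 'a"] emeasure_lborel_ball_finite[of "0 :: 'a" 1]
  by (auto simp: measure_def)

lemma prob_space_uniform_sphere: "prob_space (uniform_sphere :: 'a::euclidean_space measure)"
  unfolding uniform_sphere_def
  by (intro prob_space.prob_space_distr prob_space_uniform_measure emeasure_unit_ball_pos_finite)
     auto

lemma AE_uniform_sphere: "AE u in (uniform_sphere :: 'a::euclidean_space measure). u \<in> sphere 0 1"
proof -
  have "AE u in lborel. (u :: 'a) \<noteq> 0"
    by (rule AE_lborel_singleton)
  then show ?thesis
    unfolding uniform_sphere_def
    by (subst AE_distr_iff, simp, simp, subst AE_uniform_measure)
       (use emeasure_unit_ball_pos_finite in \<open>auto simp: norm_sgn less_top\<close>)
qed

lemma distr_orthogonal_lborel: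
  fixes T :: "'a::euclidean_space \<Rightarrow> 'a"
  assumes T: "orthogonal_transformation T"
  shows "distr lborel borel T = lborel"
proof (rule measure_eqI)
  let ?M = "distr lborel borel T"
  have T_borel [measurable]: "T \<in> borel_measurable borel"
    by (simp add: T borel_measurable_continuous_onI linear_continuous_on linear_linear
        orthogonal_transformation_linear)
  have T_add: "T (v + w) = T v + T w" for v w
    by (simp add: T linear_add orthogonal_transformation_linear)
  have translate: "(\<integral>\<^sup>+x. f (x + y) \<partial>lborel) = (\<integral>\<^sup>+x. f x \<partial>lborel)"
    if "f \<in> borel_measurable borel" for f :: "'a \<Rightarrow> ennreal" and y
    using that lborel_distr_plus[of y] nn_integral_distr[of "(+) y" lborel borel f]
    by (simp add: add.commute)
  have translate_M: "(\<integral>\<^sup>+x. f (x + y) \<partial>?M) = (\<integral>\<^sup>+x. f x \<partial>?M)"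
    if [measurable]: "f \<in> borel_measurable borel" for f :: "'a \<Rightarrow> ennreal" and y
  proof -
    obtain z where z: "y = T z"
      using T orthogonal_transformation_surj surjD by metis
    have "(\<integral>\<^sup>+x. f (x + y) \<partial>?M) = (\<integral>\<^sup>+x. f (T (x + z)) \<partial>lborel)"
      by (simp add: nn_integral_distr z T_add)
    also have "\<dots> = (\<integral>\<^sup>+x. f (T x) \<partial>lborel)"
      by (rule translate) measurable
    also have "\<dots> = (\<integral>\<^sup>+x. f x \<partial>?M)"
      by (simp add: nn_integral_distr)
    finally show ?thesis .
  qed
  have reflect: "(\<integral>\<^sup>+x. f (- x) \<partial>lborel) = (\<integral>\<^sup>+x. f x \<partial>lborel)"
    if "f \<in> borel_measurable borel" for f :: "'a \<Rightarrow> ennreal"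
    using that lborel_affine[of "-1" "0 :: 'a"] nn_integral_distr[of uminus lborel borel f]
    by (simp add: density_1)
  have ball_M: "emeasure ?M (ball 0 1) = emeasure lborel (ball (0 :: 'a) 1)"
  proof -
    have "T -` ball 0 1 = ball 0 1"
      using T by (auto simp: orthogonal_transformation_norm)
    then show ?thesis
      by (simp add: emeasure_distr)
  qed
  have sf: "sigma_finite_measure ?M"
  proof (rule sigma_finite_measure.intro, intro exI conjI ballI)
    let ?A = "range (\<lambda>n::nat. ball (0 :: 'a) (real n))"
    show "countable ?A" "?A \<subseteq> sets ?M"
      by auto
    show "\<Union> ?A = space ?M"
      using reals_Archimedean2 by auto
    fix A assume "A \<in> ?A"
    then obtain n :: nat where A: "A = ball 0 (real n)"
      by auto
    have "T -` A = A"
      using T by (auto simp: A orthogonal_transformation_norm)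
    then show "emeasure ?M A \<noteq> \<infinity>"
      using emeasure_lborel_ball_finite[of "0 :: 'a" "real n"] by (simp add: emeasure_distr A)
  qed
  interpret M: sigma_finite_measure ?M
    by (rule sf)
  interpret pair_sigma_finite ?M "lborel :: 'a measure"
    by unfold_locales
  fix A :: "'a set"
  assume "A \<in> sets ?M"
  then have [measurable]: "A \<in> sets borel"
    by simp
  let ?B = "ball (0 :: 'a) 1"
  define a b where "a = (indicator A :: 'a \<Rightarrow> ennreal)" and "b = (indicator ?B :: 'a \<Rightarrow> ennreal)"
  have [measurable]: "a \<in> borel_measurable borel" "b \<in> borel_measurable borel"
    unfolding a_def b_def by (intro borel_measurable_indicator; simp)+
  have int_a: "(\<integral>\<^sup>+x. a x \<partial>lborel) = emeasure lborel A" "(\<integral>\<^sup>+x. a x \<partial>?M) = emeasure ?M A"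
    and int_b: "(\<integral>\<^sup>+x. b x \<partial>lborel) = emeasure lborel ?B" "(\<integral>\<^sup>+x. b x \<partial>?M) = emeasure ?M ?B"
    by (simp_all add: a_def b_def)
  have "emeasure ?M A * emeasure lborel ?B = (\<integral>\<^sup>+x. a x * (\<integral>\<^sup>+y. b y \<partial>lborel) \<partial>?M)"
    by (simp add: nn_integral_multc int_a int_b)
  also have "\<dots> = (\<integral>\<^sup>+x. (\<integral>\<^sup>+y. a x * b (y + x) \<partial>lborel) \<partial>?M)"
  proof (rule nn_integral_cong)
    fix x :: 'a
    show "a x * (\<integral>\<^sup>+y. b y \<partial>lborel) = (\<integral>\<^sup>+y. a x * b (y + x) \<partial>lborel)"
      by (simp add: nn_integral_cmult translate)
  qed
  also have "\<dots> = (\<integral>\<^sup>+y. (\<integral>\<^sup>+x. a x * b (y + x) \<partial>?M) \<partial>lborel)"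
    by (rule Fubini'[symmetric]) measurable
  also have "\<dots> = (\<integral>\<^sup>+y. (\<integral>\<^sup>+x. a (x - y) * b x \<partial>?M) \<partial>lborel)"
  proof (rule nn_integral_cong)
    fix y :: 'a
    show "(\<integral>\<^sup>+x. a x * b (y + x) \<partial>?M) = (\<integral>\<^sup>+x. a (x - y) * b x \<partial>?M)"
      using translate_M[of "\<lambda>x. a (x - y) * b x" y] by (simp add: add.commute)
  qed
  also have "\<dots> = (\<integral>\<^sup>+x. (\<integral>\<^sup>+y. a (x - y) * b x \<partial>lborel) \<partial>?M)"
    by (rule Fubini') measurable
  also have "\<dots> = (\<integral>\<^sup>+x. emeasure lborel A * b x \<partial>?M)"
  proof (rule nn_integral_cong)
    fix x :: 'a
    have "(\<integral>\<^sup>+y. a (x - y) \<partial>lborel) = (\<integral>\<^sup>+y. a (x + y) \<partial>lborel)"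
      using reflect[of "\<lambda>y. a (x + y)"] by simp
    also have "\<dots> = (\<integral>\<^sup>+y. a y \<partial>lborel)"
      using translate[of a x] by (simp add: add.commute)
    finally show "(\<integral>\<^sup>+y. a (x - y) * b x \<partial>lborel) = emeasure lborel A * b x"
      by (simp add: nn_integral_multc int_a)
  qed
  also have "\<dots> = emeasure lborel A * emeasure lborel ?B"
    using ball_M by (simp add: nn_integral_cmult int_b)
  finally have "emeasure lborel ?B * emeasure ?M A = emeasure lborel ?B * emeasure lborel A"
    by (simp add: mult.commute)
  then show "emeasure ?M A = emeasure lborel A"
    using emeasure_unit_ball_pos_finite[where 'a = 'a]
    by (simp add: ennreal_mult_cancel_left)
qed simp

lemma distr_orthogonal_uniform_sphere:
  fixes T :: "'a::euclidean_space \<Rightarrow> 'a"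
  assumes T: "orthogonal_transformation T"
  shows "distr uniform_sphere borel T = uniform_sphere"
proof (rule measure_eqI)
  have T_borel [measurable]: "T \<in> borel_measurable borel"
    by (simp add: T borel_measurable_continuous_onI linear_continuous_on linear_linear
        orthogonal_transformation_linear)
  have T_sgn: "T (sgn v) = sgn (T v)" for v
    using T by (simp add: sgn_div_norm orthogonal_transformation_norm linear_cmul
        orthogonal_transformation_linear)
  fix A :: "'a set"
  assume "A \<in> sets (distr uniform_sphere borel T)"
  then have A [measurable]: "A \<in> sets borel"
    by simp
  let ?B = "ball (0 :: 'a) 1"
  have "emeasure (distr uniform_sphere borel T) A = emeasure uniform_sphere (T -` A)"
    by (subst emeasure_distr) auto
  also have "\<dots> = emeasure (uniform_measure lborel ?B) (sgn -` T -` A)"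
    unfolding uniform_sphere_def by (subst emeasure_distr) (auto intro: measurable_sets_borel[OF T_borel])
  also have "\<dots> = emeasure lborel (?B \<inter> sgn -` T -` A) / emeasure lborel ?B"
    by (subst emeasure_uniform_measure)
       (auto intro!: measurable_sets_borel[OF borel_measurable_sgn] measurable_sets_borel[OF T_borel])
  also have "?B \<inter> sgn -` T -` A = T -` (?B \<inter> sgn -` A)"
    using T by (auto simp: T_sgn orthogonal_transformation_norm)
  also have "emeasure lborel (T -` (?B \<inter> sgn -` A)) = emeasure (distr lborel borel T) (?B \<inter> sgn -` A)"
    by (subst emeasure_distr) (auto intro!: measurable_sets_borel[OF borel_measurable_sgn])
  also have "\<dots> = emeasure lborel (?B \<inter> sgn -` A)"
    by (simp only: distr_orthogonal_lborel[OF T])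
  also have "\<dots> / emeasure lborel ?B = emeasure (uniform_measure lborel ?B) (sgn -` A)"
    by (subst emeasure_uniform_measure) (auto intro!: measurable_sets_borel[OF borel_measurable_sgn])
  also have "\<dots> = emeasure uniform_sphere A"
    unfolding uniform_sphere_def by (subst emeasure_distr) auto
  finally show "emeasure (distr uniform_sphere borel T) A = emeasure uniform_sphere A" .
qed simp

text \<open>
  Here \<open>x\<^sub>(\<^sub>i\<^sub>)\<close> is \<open>x (\<sigma> i)\<close>. Ties may be broken arbitrarily, so \<open>\<sigma>\<close> need not be unique.
  Points are handled through their indices, so repeated points count with multiplicity.
\<close>

definition distance_ordering ::
    "'a::real_normed_vector \<Rightarrow> nat \<Rightarrow> (nat \<Rightarrow> 'a) \<Rightarrow> (nat \<Rightarrow> nat) \<Rightarrow> bool" where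
  "distance_ordering q n x \<sigma> \<longleftrightarrow>
     \<sigma> permutes {1..n} \<and> mono_on {1..n} (\<lambda>i. norm (q - x (\<sigma> i)))"

text \<open>
  The last argument is the already ordered sequence \<open>x\<^sub>(\<^sub>1\<^sub>), x\<^sub>(\<^sub>2\<^sub>), \<dots>\<close>. Only its distances
  to \<open>q\<close> matter, so the value does not depend on how ties were broken.
  A summand with \<open>x\<^sub>(\<^sub>i\<^sub>) = q\<close> is read as \<open>0\<close>: then the first \<open>k\<close> points coincide with \<open>q\<close> as well,
  and no projection lies strictly between theirs and that of \<open>q\<close>.
\<close>

definition Phi :: "nat \<Rightarrow> nat \<Rightarrow> 'a::real_normed_vector \<Rightarrow> (nat \<Rightarrow> 'a) \<Rightarrow> real" where
  "Phi k m q y =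
     (1 / real m) * (\<Sum>i = k+1..m. ((\<Sum>j = 1..k. norm (q - y j)) / real k) / norm (q - y i))"

text \<open>
  On the reals, \<^term>\<open>open_segment a b\<close> is the set of points strictly between \<open>a\<close> and \<open>b\<close>, in
  either order; it is empty for \<open>a = b\<close>. Events phrased with it, as below, are Borel sets.
\<close>

lemma open_segment_real_iff:
  fixes a b c :: real
  shows "c \<in> open_segment a b \<longleftrightarrow> a < c \<and> c < b \<or> b < c \<and> c < a"
  by (auto simp: open_segment_eq_real_ivl)

lemma borel_many_strictly_between:
  fixes x :: "nat \<Rightarrow> 'a::euclidean_space" and k :: nat
  assumes "finite S"
  shows "{u. \<exists>j\<in>{1..k}. c \<le> real (card {i \<in> S. x i \<bullet> u \<in> open_segment (x (\<sigma> j) \<bullet> u) (q \<bullet> u)})}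
    \<in> sets borel"
proof -
  have card_eq: "real (card {i \<in> S. P i}) = (\<Sum>i\<in>S. if P i then 1 else 0)" for P
    using assms by (simp add: sum.If_cases Int_def)
  have [measurable]: "(\<lambda>u. \<Sum>i\<in>S. if x i \<bullet> u \<in> open_segment (x (\<sigma> j) \<bullet> u) (q \<bullet> u) then 1 else 0 :: real)
      \<in> borel_measurable borel" for j
    unfolding open_segment_real_iff by measurable
  have "{u. c \<le> real (card {i \<in> S. x i \<bullet> u \<in> open_segment (x (\<sigma> j) \<bullet> u) (q \<bullet> u)})} \<in> sets borel" for j
    unfolding card_eq by measurable
  then have "(\<Union>j\<in>{1..k}. {u. c \<le> real (card {i \<in> S. x i \<bullet> u \<in> open_segment (x (\<sigma> j) \<bullet> u) (q \<bullet> u)})})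
      \<in> sets borel"
    by (intro sets.finite_UN) auto
  also have "(\<Union>j\<in>{1..k}. {u. c \<le> real (card {i \<in> S. x i \<bullet> u \<in> open_segment (x (\<sigma> j) \<bullet> u) (q \<bullet> u)})}) =
      {u. \<exists>j\<in>{1..k}. c \<le> real (card {i \<in> S. x i \<bullet> u \<in> open_segment (x (\<sigma> j) \<bullet> u) (q \<bullet> u)})}"
    by blast
  finally show ?thesis .
qed

end

theory Submission
  imports Defs
begin

text \<open>
  After translating \<open>q\<close> to the origin, \<open>y\<close> projects strictly between \<open>q\<close> and \<open>x\<close> iff the random
  hyperplane orthogonal to \<open>U\<close> separates the vectors \<open>y\<close> and \<open>y - x\<close>. A random hyperplane separates
  two vectors with probability at most their angle over \<open>\<pi>\<close>, and if \<open>\<parallel>x\<parallel> \<le> \<parallel>y\<parallel>\<close> the angle at \<open>y\<close> of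
  the triangle \<open>0, x, y\<close> is at most \<open>(\<pi>/2) \<parallel>x\<parallel> / \<parallel>y\<parallel>\<close>. The theorem follows by Markov's inequality
  applied to the number of intermediate points outside the \<open>k\<close> nearest ones, and a union bound.

  The hyperplane bound is obtained without integrating: rotating by the angle \<open>\<phi>\<close> between the two
  vectors \<open>m\<close> times leaves the probability unchanged, whereas for a fixed direction the number of
  sign changes of \<open>cos\<close> along \<open>\<psi>, \<psi> + \<phi>, \<dots>, \<psi> + m\<phi>\<close> is at most \<open>m\<phi>/\<pi> + 1\<close>.
\<close>

section \<open>Sign changes of the cosine along an arithmetic progression\<close>

text \<open>The floor indexes the interval from \<open>N * pi - pi/2\<close> to
  \<open>N * pi + pi/2\<close> between consecutive zeros of \<open>cos\<close>. Shifting both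
  arguments by \<open>N * pi\<close> makes both cosines nonnegative, and the common factor
  \<open>cos (N * pi)\<close> enters squared.\<close>

lemma cos_mult_nonneg_same_floor:
  fixes a b :: real
  assumes "\<lfloor>a / pi + 1/2\<rfloor> = \<lfloor>b / pi + 1/2\<rfloor>"
  shows "0 \<le> cos a * cos b"
proof -
  define N where "N = \<lfloor>b / pi + 1/2\<rfloor>"
  have *: "0 \<le> cos (c - of_int N * pi)" "cos c = cos (of_int N * pi) * cos (c - of_int N * pi)"
    if "\<lfloor>c / pi + 1/2\<rfloor> = N" for c
  proof -
    have "of_int N \<le> c / pi + 1/2" "c / pi + 1/2 < of_int N + 1"
      using that by linarith+
    then have "of_int N * pi \<le> (c / pi + 1/2) * pi" "(c / pi + 1/2) * pi < (of_int N + 1) * pi"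
      by (auto intro: mult_right_mono mult_strict_right_mono)
    then show "0 \<le> cos (c - of_int N * pi)"
      by (intro cos_ge_zero) (auto simp: algebra_simps)
    have "sin (of_int N * pi) = 0"
      by (simp add: sin_zero_iff_int2)
    then show "cos c = cos (of_int N * pi) * cos (c - of_int N * pi)"
      using cos_add[of "of_int N * pi" "c - of_int N * pi"] by simp
  qed
  have "cos a * cos b = (cos (of_int N * pi))\<^sup>2 * (cos (a - of_int N * pi) * cos (b - of_int N * pi))"
    using *(2)[of a] *(2)[of b] assms by (simp add: N_def power2_eq_square mult_ac)
  moreover have "0 \<le> cos (a - of_int N * pi)" "0 \<le> cos (b - of_int N * pi)"
    using *(1)[of a] *(1)[of b] assms by (simp_all add: N_def)
  ultimately show ?thesis
    by simp
qed

text \<open>Each sign change forces the nondecreasing floor index to grow by at least one, so the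
  count is bounded by a telescoping sum. The extra 1 is the rounding loss of the floors.\<close>

lemma card_cos_sign_changes_le:
  fixes \<psi> \<phi> :: real
  assumes "0 \<le> \<phi>"
  shows "(\<Sum>j<m. of_bool (cos (\<psi> + real j * \<phi>) * cos (\<psi> + real (Suc j) * \<phi>) < 0))
    \<le> real m * \<phi> / pi + 1"
proof -
  define N where "N j = \<lfloor>(\<psi> + real j * \<phi>) / pi + 1/2\<rfloor>" for j
  have "of_bool (cos (\<psi> + real j * \<phi>) * cos (\<psi> + real (Suc j) * \<phi>) < 0)
      \<le> real_of_int (N (Suc j)) - real_of_int (N j)" for j
  proof -
    have "N j \<le> N (Suc j)"
      unfolding N_def using assms
      by (intro floor_mono add_right_mono divide_right_mono add_left_mono mult_right_mono) auto
    moreover have "N j \<noteq> N (Suc j)" if "cos (\<psi> + real j * \<phi>) * cos (\<psi> + real (Suc j) * \<phi>) < 0"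
      using cos_mult_nonneg_same_floor that unfolding N_def by fastforce
    ultimately show ?thesis
      by (auto simp: of_bool_def)
  qed
  then have "(\<Sum>j<m. of_bool (cos (\<psi> + real j * \<phi>) * cos (\<psi> + real (Suc j) * \<phi>) < 0))
      \<le> (\<Sum>j<m. real_of_int (N (Suc j)) - real_of_int (N j))"
    by (rule sum_mono)
  also have "\<dots> = real_of_int (N m) - real_of_int (N 0)"
    by (rule sum_lessThan_telescope)
  also have "\<dots> \<le> ((\<psi> + real m * \<phi>) / pi + 1/2) - (\<psi> / pi + 1/2 - 1)"
    unfolding N_def by (intro diff_mono) (simp, simp, linarith)
  also have "\<dots> = real m * \<phi> / pi + 1"
    by (simp add: add_divide_distrib)
  finally show ?thesis .
qed

section \<open>Plane rotations and separation by a random hyperplane\<close>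

text \<open>For orthonormal \<open>e\<close>, \<open>f\<close> this is the rotation from
  \<open>e\<close> towards \<open>f\<close>, fixing their orthogonal complement. Writing it as a
  correction to \<open>v\<close> avoids completing \<open>e\<close>, \<open>f\<close> to a
  basis.\<close>

definition plane_rotation :: "'a::real_inner \<Rightarrow> 'a \<Rightarrow> real \<Rightarrow> 'a \<Rightarrow> 'a" where
  "plane_rotation e f \<theta> v =
     v + ((cos \<theta> - 1) * (e \<bullet> v) - sin \<theta> * (f \<bullet> v)) *\<^sub>R e
       + (sin \<theta> * (e \<bullet> v) + (cos \<theta> - 1) * (f \<bullet> v)) *\<^sub>R f"

context
  fixes e f :: "'a::euclidean_space"
  assumes ef: "e \<bullet> e = 1" "f \<bullet> f = 1" "e \<bullet> f = 0"
begin

lemma inner_plane_rotation: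
  "e \<bullet> plane_rotation e f \<theta> v = cos \<theta> * (e \<bullet> v) - sin \<theta> * (f \<bullet> v)"
  "f \<bullet> plane_rotation e f \<theta> v = sin \<theta> * (e \<bullet> v) + cos \<theta> * (f \<bullet> v)"
  using ef by (simp_all add: plane_rotation_def inner_add_right inner_commute algebra_simps)

lemma orthogonal_plane_rotation: "orthogonal_transformation (plane_rotation e f \<theta>)"
  unfolding orthogonal_transformation_def
proof (intro conjI allI)
  show "linear (plane_rotation e f \<theta>)"
    by (rule linearI) (simp_all add: plane_rotation_def inner_add_right algebra_simps)
  fix v w
  have expand: "(v + A *\<^sub>R e + B *\<^sub>R f) \<bullet> (w + C *\<^sub>R e + D *\<^sub>R f)
      = v \<bullet> w + C * (e \<bullet> v) + D * (f \<bullet> v) + A * (e \<bullet> w) + B * (f \<bullet> w) + A * C + B * D" for A B C D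
    using ef by (simp add: inner_add_left inner_add_right inner_commute[of v] inner_commute[of f e] algebra_simps)
  have "plane_rotation e f \<theta> v \<bullet> plane_rotation e f \<theta> w
      = v \<bullet> w + ((e \<bullet> v) * (e \<bullet> w) + (f \<bullet> v) * (f \<bullet> w)) * ((sin \<theta>)\<^sup>2 + (cos \<theta>)\<^sup>2 - 1)"
    unfolding plane_rotation_def expand by algebra
  then show "plane_rotation e f \<theta> v \<bullet> plane_rotation e f \<theta> w = v \<bullet> w"
    by simp
qed

lemma prob_opposite_signs_le:
  assumes \<phi>: "0 \<le> \<phi>"
  shows "measure uniform_sphere {u. (e \<bullet> u) * ((cos \<phi> *\<^sub>R e - sin \<phi> *\<^sub>R f) \<bullet> u) < 0} \<le> \<phi> / pi"
proof -
  interpret prob_space "uniform_sphere :: 'a measure"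
    by (rule prob_space_uniform_sphere)
  define W where "W = {u. (e \<bullet> u) * ((cos \<phi> *\<^sub>R e - sin \<phi> *\<^sub>R f) \<bullet> u) < 0}"
  have W [measurable]: "W \<in> sets borel"
    unfolding W_def by measurable
  define R where "R j = plane_rotation e f (real j * \<phi>)" for j
  have R [measurable]: "R j \<in> borel_measurable borel" for j
    unfolding R_def using orthogonal_plane_rotation
    by (simp add: borel_measurable_continuous_onI linear_continuous_on linear_linear
        orthogonal_transformation_linear)
  have RW [measurable]: "R j -` W \<in> sets borel" for j
    using measurable_sets_borel[OF R W] .
  have prob_RW: "measure uniform_sphere (R j -` W) = measure uniform_sphere W" for j
  proof -
    have "measure uniform_sphere W = measure (distr uniform_sphere borel (R j)) W"
      unfolding R_def by (simp add: distr_orthogonal_uniform_sphere[OF orthogonal_plane_rotation])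
    then show ?thesis
      by (simp add: measure_distr)
  qed
  have count: "(\<Sum>j<m. indicator (R j -` W) u) \<le> real m * \<phi> / pi + 1" for m u
  proof -
    \<comment> \<open>Polar coordinates in the plane of \<open>e\<close> and \<open>f\<close>:
      \<open>R j\<close> adds \<open>j * \<phi>\<close> to the angle.\<close>
    obtain r \<psi> where r: "e \<bullet> u = r * cos \<psi>" "f \<bullet> u = r * sin \<psi>"
      using polar_Ex by blast
    have e_R: "e \<bullet> R j u = r * cos (\<psi> + real j * \<phi>)"
      and f_R: "f \<bullet> R j u = r * sin (\<psi> + real j * \<phi>)" for j
      unfolding R_def inner_plane_rotation r by (simp_all add: cos_add sin_add algebra_simps)
    have "(cos \<phi> *\<^sub>R e - sin \<phi> *\<^sub>R f) \<bullet> R j u = r * cos ((\<psi> + real j * \<phi>) + \<phi>)" for j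
      unfolding inner_diff_left inner_scaleR_left e_R f_R cos_add[of _ \<phi>] by algebra
    moreover have "(\<psi> + real j * \<phi>) + \<phi> = \<psi> + real (Suc j) * \<phi>" for j
      by (simp add: algebra_simps)
    ultimately have "u \<in> R j -` W \<longleftrightarrow>
        r\<^sup>2 * (cos (\<psi> + real j * \<phi>) * cos (\<psi> + real (Suc j) * \<phi>)) < 0" for j
      by (simp only: W_def vimage_eq mem_Collect_eq e_R power2_eq_square mult_ac)
    \<comment> \<open>Only an inequality, since \<open>r = 0\<close> when \<open>u\<close> is
      orthogonal to the plane.\<close>
    then have "indicator (R j -` W) u
        \<le> (of_bool (cos (\<psi> + real j * \<phi>) * cos (\<psi> + real (Suc j) * \<phi>) < 0) :: real)" for j
      by (auto simp: indicator_def mult_less_0_iff[of "r\<^sup>2"])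
    then have "(\<Sum>j<m. indicator (R j -` W) u)
        \<le> (\<Sum>j<m. of_bool (cos (\<psi> + real j * \<phi>) * cos (\<psi> + real (Suc j) * \<phi>) < 0) :: real)"
      by (rule sum_mono)
    also have "\<dots> \<le> real m * \<phi> / pi + 1"
      by (rule card_cos_sign_changes_le[OF \<phi>])
    finally show ?thesis .
  qed
  \<comment> \<open>Integrating \<open>count\<close> over \<open>Suc m\<close> rotations turns its
    additive 1 into \<open>1 / Suc m\<close>, which vanishes in the limit.\<close>
  have bound: "measure uniform_sphere W \<le> \<phi> / pi + 1 / real (Suc m)" for m
  proof -
    have "real (Suc m) * measure uniform_sphere W = (\<Sum>j<Suc m. measure uniform_sphere (R j -` W))"
      by (simp add: prob_RW)
    also have "\<dots> = (\<integral>u. (\<Sum>j<Suc m. indicator (R j -` W) u) \<partial>uniform_sphere)"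
      by (subst Bochner_Integration.integral_sum) (auto simp: emeasure_eq_measure)
    also have "\<dots> \<le> (\<integral>u. real (Suc m) * \<phi> / pi + 1 \<partial>(uniform_sphere :: 'a measure))"
      by (intro integral_mono count) (auto simp: emeasure_eq_measure)
    also have "\<dots> = real (Suc m) * (\<phi> / pi + 1 / real (Suc m))"
      by (simp add: prob_space[simplified] distrib_left del: of_nat_Suc)
    finally show ?thesis
      by (subst (asm) mult_le_cancel_left_pos) auto
  qed
  have "(\<lambda>m. \<phi> / pi + 1 / real (Suc m)) \<longlonglongrightarrow> \<phi> / pi + 0"
    by (intro tendsto_intros LIMSEQ_inverse_real_of_nat[unfolded inverse_eq_divide])
  then have "measure uniform_sphere W \<le> \<phi> / pi + 0"
    by (rule LIMSEQ_le_const) (use bound in auto)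
  then show ?thesis
    by (simp add: W_def)
qed

end

lemma prob_hyperplane_separates_le:
  fixes a b :: "'a::euclidean_space"
  shows "measure uniform_sphere {u. (a \<bullet> u) * (b \<bullet> u) < 0} \<le> arccos (sgn a \<bullet> sgn b) / pi"
proof (cases "a = 0 \<or> b = 0")
  case True
  then show ?thesis
    by auto
next
  case False
  interpret prob_space "uniform_sphere :: 'a measure"
    by (rule prob_space_uniform_sphere)
  define e g where "e = sgn a" and "g = sgn b"
  have unit: "e \<bullet> e = 1" "g \<bullet> g = 1"
    using False by (simp_all add: e_def g_def norm_sgn flip: norm_eq_1)
  have sep: "{u. (a \<bullet> u) * (b \<bullet> u) < 0} = {u. (e \<bullet> u) * (g \<bullet> u) < 0}"
  proof -
    have "a = norm a *\<^sub>R e" "b = norm b *\<^sub>R g"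
      using False by (simp_all add: e_def g_def sgn_div_norm)
    then have "(a \<bullet> u) * (b \<bullet> u) = (norm a * norm b) * ((e \<bullet> u) * (g \<bullet> u))" for u
      by (metis inner_scaleR_left mult.assoc mult.left_commute)
    moreover have "0 < norm a * norm b"
      using False by simp
    ultimately show ?thesis
      using mult_less_cancel_left_pos[of "norm a * norm b" _ 0] by simp
  qed
  define \<phi> where "\<phi> = arccos (e \<bullet> g)"
  have abs_le: "\<bar>e \<bullet> g\<bar> \<le> 1"
    using Cauchy_Schwarz_ineq2[of e g] unit by (simp add: norm_eq_sqrt_inner)
  then have \<phi>: "cos \<phi> = e \<bullet> g" "0 \<le> \<phi>" "\<phi> \<le> pi"
    by (auto simp: \<phi>_def cos_arccos_abs abs_le_iff intro!: arccos_lbound arccos_ubound)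
  have "measure uniform_sphere {u. (e \<bullet> u) * (g \<bullet> u) < 0} \<le> \<phi> / pi"
  proof (cases "sin \<phi> = 0")
    case True
    \<comment> \<open>For \<open>\<phi> = 0\<close> the unit vectors coincide and the product is a
      square; for \<open>\<phi> = pi\<close> the bound is 1.\<close>
    consider "\<phi> = 0" | "\<phi> = pi"
      using True \<phi> sin_gt_zero[of \<phi>] by fastforce
    then show ?thesis
    proof cases
      case 1
      then have "(e - g) \<bullet> (e - g) = 0"
        using \<phi>(1) unit by (simp add: inner_diff inner_commute)
      then have "{u. (e \<bullet> u) * (g \<bullet> u) < 0} = {}"
        by (auto simp: mult_less_0_iff)
      then show ?thesis
        using 1 by simp
    qed simp
  next
    case False
    \<comment> \<open>Gram-Schmidt, with the sign chosen so that \<open>g\<close> takes the form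
      required by \<open>prob_opposite_signs_le\<close>.\<close>
    define f where "f = (cos \<phi> *\<^sub>R e - g) /\<^sub>R sin \<phi>"
    have "e \<bullet> f = 0"
      using \<phi>(1) unit by (simp add: f_def inner_diff_right)
    moreover have "f \<bullet> f = 1"
    proof -
      have "(cos \<phi> *\<^sub>R e - g) \<bullet> (cos \<phi> *\<^sub>R e - g) = 1 - (cos \<phi>)\<^sup>2"
        using \<phi>(1) unit by (simp add: inner_diff inner_commute power2_eq_square)
      also have "\<dots> = (sin \<phi>)\<^sup>2"
        by (simp add: sin_squared_eq)
      finally show ?thesis
        using False by (simp add: f_def power2_eq_square) (simp add: field_simps)
    qed
    moreover have "cos \<phi> *\<^sub>R e - sin \<phi> *\<^sub>R f = g"
      using False by (simp add: f_def)
    ultimately show ?thesis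
      using prob_opposite_signs_le[of e f \<phi>] unit \<phi> by simp
  qed
  then show ?thesis
    by (simp add: sep \<phi>_def e_def g_def)
qed

section \<open>The angle estimate and the probability for one intermediate point\<close>

text \<open>By concavity, \<open>sin\<close> lies above its chord from 0 to
  \<open>pi / 2\<close>.\<close>

lemma Jordan_sin_ge:
  fixes x :: real
  assumes "0 \<le> x" "x \<le> pi / 2"
  shows "2 / pi * x \<le> sin x"
proof -
  have "concave_on {0..pi / 2} (sin :: real \<Rightarrow> real)"
    by (rule f''_le0_imp_concave[where f' = cos and f'' = "\<lambda>x. - sin x"])
       (auto intro!: derivative_eq_intros sin_ge_zero)
  from concave_onD_Icc'[OF this, of x] show ?thesis
    using assms by simp
qed

text \<open>The distance from 0 to the line through \<open>x\<close> and \<open>y\<close> is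
  \<open>norm y\<close> times the sine of the angle at \<open>y\<close>, and is at most
  \<open>norm x\<close>. The angle is not obtuse because \<open>norm x \<le> norm y\<close>, so
  Jordan's inequality converts the sine bound into an angle bound.\<close>

lemma arccos_triangle_angle_le:
  fixes x y :: "'a::real_inner"
  assumes le: "norm x \<le> norm y" and ne: "y \<noteq> 0" "y \<noteq> x"
  shows "arccos (sgn y \<bullet> sgn (y - x)) \<le> pi / 2 * (norm x / norm y)"
proof -
  define c where "c = sgn y \<bullet> sgn (y - x)"
  have c: "c = (y \<bullet> (y - x)) / (norm y * norm (y - x))"
    by (simp add: c_def sgn_div_norm divide_simps)
  have "x \<bullet> y \<le> norm x * norm y"
    by (rule norm_cauchy_schwarz)
  also have "\<dots> \<le> norm y * norm y"
    using le by (intro mult_right_mono) auto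
  also have "\<dots> = y \<bullet> y"
    by (simp add: dot_square_norm power2_eq_square)
  finally have "0 \<le> y \<bullet> (y - x)"
    by (simp add: inner_diff_right inner_commute)
  then have c0: "0 \<le> c"
    by (simp add: c)
  have c1: "c \<le> 1"
    using norm_cauchy_schwarz[of y "y - x"] ne by (simp add: c)
  define \<phi> where "\<phi> = arccos c"
  have \<phi>: "0 \<le> \<phi>" "\<phi> \<le> pi / 2" "cos \<phi> = c"
    using c0 c1 arccos_lbound[of c] arccos_le_pi2[of c] by (simp_all add: \<phi>_def)
  \<comment> \<open>Since \<open>y = x + (y - x)\<close>, the pairs \<open>y, y - x\<close> and
    \<open>x, y - x\<close> have the same Gram determinant.\<close>
  have "(y \<bullet> y) * ((y - x) \<bullet> (y - x)) - (y \<bullet> (y - x))\<^sup>2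
      = (x \<bullet> x) * ((y - x) \<bullet> (y - x)) - (x \<bullet> (y - x))\<^sup>2"
    by (simp add: inner_diff inner_commute[of y x] power2_eq_square algebra_simps)
  also have "\<dots> \<le> (x \<bullet> x) * ((y - x) \<bullet> (y - x))"
    by simp
  finally have gram: "(norm y)\<^sup>2 * (norm (y - x))\<^sup>2 - (y \<bullet> (y - x))\<^sup>2 \<le> (norm x)\<^sup>2 * (norm (y - x))\<^sup>2"
    by (simp add: dot_square_norm)
  have "(sin \<phi>)\<^sup>2 = 1 - c\<^sup>2"
    using \<phi> by (simp add: sin_squared_eq)
  also have "\<dots> = ((norm y)\<^sup>2 * (norm (y - x))\<^sup>2 - (y \<bullet> (y - x))\<^sup>2) / ((norm y)\<^sup>2 * (norm (y - x))\<^sup>2)"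
    using ne by (simp add: c power_divide power_mult_distrib diff_divide_distrib)
  also have "\<dots> \<le> (norm x)\<^sup>2 * (norm (y - x))\<^sup>2 / ((norm y)\<^sup>2 * (norm (y - x))\<^sup>2)"
    using gram by (intro divide_right_mono) auto
  also have "\<dots> = (norm x / norm y)\<^sup>2"
    using ne by (simp add: power_divide)
  finally have "sin \<phi> \<le> norm x / norm y"
    by (rule power2_le_imp_le) simp
  moreover have "2 / pi * \<phi> \<le> sin \<phi>"
    using \<phi> by (intro Jordan_sin_ge)
  ultimately have "2 / pi * \<phi> \<le> norm x / norm y"
    by linarith
  then show ?thesis
    by (simp add: \<phi>_def c_def field_simps)
qed

lemma prob_strictly_between_le:
  fixes q x y :: "'a::euclidean_space"
  assumes le: "norm (q - x) \<le> norm (q - y)"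
  shows "measure uniform_sphere {u. y \<bullet> u \<in> open_segment (x \<bullet> u) (q \<bullet> u)}
    \<le> norm (q - x) / (2 * norm (q - y))"
proof -
  have eq: "{u. y \<bullet> u \<in> open_segment (x \<bullet> u) (q \<bullet> u)}
      = {u. ((y - q) \<bullet> u) * (((y - q) - (x - q)) \<bullet> u) < 0}"
    by (auto simp: open_segment_real_iff inner_diff_left mult_less_0_iff)
  show ?thesis
  \<comment> \<open>For \<open>y = q\<close> the right-hand side is 0 by the convention for division
    by zero, which the empty event respects.\<close>
  proof (cases "y = q \<or> y = x")
    case True
    then have "{u. y \<bullet> u \<in> open_segment (x \<bullet> u) (q \<bullet> u)} = {}"
      by (auto simp: open_segment_real_iff)
    then show ?thesis
      by simp
  next
    case False
    have "measure uniform_sphere {u. y \<bullet> u \<in> open_segment (x \<bullet> u) (q \<bullet> u)}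
        \<le> arccos (sgn (y - q) \<bullet> sgn ((y - q) - (x - q))) / pi"
      unfolding eq by (rule prob_hyperplane_separates_le)
    also have "\<dots> \<le> (pi / 2 * (norm (x - q) / norm (y - q))) / pi"
      using False le
      by (intro divide_right_mono arccos_triangle_angle_le) (auto simp: norm_minus_commute)
    finally show ?thesis
      by (simp add: norm_minus_commute)
  qed
qed

section \<open>Markov's inequality for counts and a rearrangement bound\<close>

lemma (in prob_space) Markov_card_le:
  fixes A :: "'i \<Rightarrow> 'a set"
  assumes "finite I" and A: "\<And>i. i \<in> I \<Longrightarrow> A i \<in> events" and B: "B \<in> events"
    and le: "\<And>u. u \<in> B \<Longrightarrow> c \<le> real (card {i \<in> I. u \<in> A i})"
  shows "c * prob B \<le> (\<Sum>i\<in>I. prob (A i))"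
proof -
  have card_eq: "real (card {i \<in> I. u \<in> A i}) = (\<Sum>i\<in>I. indicator (A i) u)" for u
    using \<open>finite I\<close> by (simp add: indicator_def sum.If_cases Int_def)
  have "c * prob B = (\<integral>u. c * indicator B u \<partial>M)"
    using B by simp
  also have "\<dots> \<le> (\<integral>u. (\<Sum>i\<in>I. indicator (A i) u) \<partial>M)"
  proof (rule integral_mono)
    fix u
    show "c * indicator B u \<le> (\<Sum>i\<in>I. indicator (A i) u :: real)"
      using le[of u] by (auto simp: card_eq indicator_def intro: sum_nonneg)
  qed (use A B in \<open>auto simp: emeasure_eq_measure\<close>)
  also have "\<dots> = (\<Sum>i\<in>I. prob (A i))"
    using A by (subst Bochner_Integration.integral_sum) (auto simp: emeasure_eq_measure)
  finally show ?thesis .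
qed

text \<open>Induction removing the maximum: \<open>J\<close> fits into \<open>{a..Max J}\<close>, so
  \<open>Max J\<close> is at or beyond the last index of the initial segment, where \<open>g\<close>
  is no larger.\<close>

lemma sum_le_sum_initial_segment:
  fixes g :: "nat \<Rightarrow> real"
  assumes "antimono_on {a..b} g" "J \<subseteq> {a..b}"
  shows "(\<Sum>i\<in>J. g i) \<le> (\<Sum>i=a..<a + card J. g i)"
  using assms(2)
proof (induction "card J" arbitrary: J)
  case 0
  then have "J = {}"
    using finite_subset[OF 0(2)] by simp
  then show ?case
    by simp
next
  case (Suc c)
  have fin: "finite J"
    using Suc.prems finite_subset by blast
  then have M: "Max J \<in> J"
    using Suc.hyps(2) by (intro Max_in) auto
  have "J \<subseteq> {a..Max J}"
    using fin Suc.prems by auto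
  then have "Suc c \<le> Suc (Max J) - a"
    using card_mono[of "{a..Max J}" J] Suc.hyps(2) by simp
  moreover have "a \<le> Max J" "Max J \<le> b"
    using M Suc.prems by auto
  ultimately have "g (Max J) \<le> g (a + c)"
    by (intro monotone_onD[OF assms(1)]) auto
  moreover have "(\<Sum>i\<in>J - {Max J}. g i) \<le> (\<Sum>i=a..<a + c. g i)"
  proof -
    have "card (J - {Max J}) = c"
      using M Suc.hyps(2) by simp
    then show ?thesis
      using Suc.hyps(1)[of "J - {Max J}"] Suc.prems by auto
  qed
  ultimately show ?case
    using fin M Suc.hyps(2)[symmetric] by (simp add: sum.remove)
qed

section \<open>Union bound over the nearest points and comparison with \<open>Phi\<close>\<close>

theorem theorem5:
  fixes q :: "real ^ 'd" and x :: "nat \<Rightarrow> real ^ 'd"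
    and n k :: nat and \<sigma> :: "nat \<Rightarrow> nat" and S :: "nat set" and \<alpha> :: real
  assumes "distance_ordering q n x \<sigma>"
    and "1 \<le> k" and "k \<le> n"
    and "S \<subseteq> {1..n}" and "\<sigma> ` {1..k} \<subseteq> S"
    and "0 < \<alpha>" and "\<alpha> < 1" and "real k < \<alpha> * real (card S) + 1"
  shows "\<P>(u in uniform_sphere. \<exists>j\<in>{1..k}.
            \<alpha> * real (card S) \<le> real (card {i \<in> S. x i \<bullet> u \<in> open_segment (x (\<sigma> j) \<bullet> u) (q \<bullet> u)}))
         \<le> real k / (2 * (\<alpha> - (real k - 1) / real (card S))) * Phi k (card S) q (x \<circ> \<sigma>)"
proof -
  interpret prob_space "uniform_sphere :: (real ^ 'd) measure"
    by (rule prob_space_uniform_sphere)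
  have perm: "\<sigma> permutes {1..n}" and mono: "mono_on {1..n} (\<lambda>i. norm (q - x (\<sigma> i)))"
    using assms(1) by (auto simp: distance_ordering_def)
  have inj: "inj \<sigma>"
    using perm by (rule permutes_inj)
  have fin: "finite S"
    using assms(4) finite_subset by blast
  define m where "m = card S"
  have card_near: "card (\<sigma> ` {1..k}) = k"
    using inj by (simp add: card_image inj_on_subset)
  then have km: "k \<le> m"
    using card_mono[OF fin assms(5)] by (simp add: m_def)
  define S' where "S' = S - \<sigma> ` {1..k}"
  define between where "between i j = {u. x i \<bullet> u \<in> open_segment (x (\<sigma> j) \<bullet> u) (q \<bullet> u)}" for i j
  have between [measurable]: "between i j \<in> sets borel" for i j
    unfolding between_def open_segment_real_iff by measurable
  define D where "D = (\<Sum>j=1..k. norm (q - x (\<sigma> j)))"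
  define w where "w i = D / norm (q - x i)" for i
  \<comment> \<open>On \<open>E j\<close>, at least \<open>c\<close> far points are intermediate: of
    the \<open>k\<close> nearest points, at most \<open>k - 1\<close> can be.\<close>
  define c where "c = \<alpha> * real m - (real k - 1)"
  have c: "0 < c"
    using assms(8) by (simp add: c_def m_def)
  define E where "E j = {u. \<alpha> * real m \<le> real (card {i \<in> S. u \<in> between i j})}" for j
  \<comment> \<open>A one-element index range and a constant index map isolate a single
    \<open>j\<close>.\<close>
  have E [measurable]: "E j \<in> sets borel" for j
    using borel_many_strictly_between[OF fin, of 1 "\<alpha> * real m" x "\<lambda>_. \<sigma> j" q]
    by (simp add: E_def between_def)

  \<comment> \<open>\<open>J\<close> collects the distance ranks of the far points of
    \<open>S\<close>.\<close>
  obtain J where J: "J \<subseteq> {k + 1..n}" "S' = \<sigma> ` J"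
  proof
    show "S' = \<sigma> ` (inv \<sigma> ` S')"
      using perm by (simp add: image_image permutes_inverses)
    show "inv \<sigma> ` S' \<subseteq> {k + 1..n}"
    proof
      fix i assume "i \<in> inv \<sigma> ` S'"
      then have "\<sigma> i \<in> S'"
        using perm by (auto simp: permutes_inverses)
      then have "i \<in> {1..n}" "i \<notin> {1..k}"
        using assms(4) permutes_in_image[OF perm] by (auto simp: S'_def)
      then show "i \<in> {k + 1..n}"
        by auto
    qed
  qed
  have "card S' = m - k"
    using fin assms(5) card_near by (simp add: S'_def m_def card_Diff_subset finite_subset)
  then have card_J: "card J = m - k"
    using J inj by (simp add: card_image inj_on_subset)

  have prob_between: "prob (between i j) \<le> norm (q - x (\<sigma> j)) / (2 * norm (q - x i))"
    if i: "i \<in> S'" and j: "j \<in> {1..k}" for i j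
  proof -
    obtain l where "l \<in> J" "i = \<sigma> l"
      using J i by auto
    then show ?thesis
      unfolding between_def using J j assms(3)
      by (intro prob_strictly_between_le) (auto intro!: mono_onD[OF mono])
  qed
  have prob_E: "c * prob (E j) \<le> (\<Sum>i\<in>S'. prob (between i j))" if j: "j \<in> {1..k}" for j
  proof (rule Markov_card_le)
    fix u assume "u \<in> E j"
    \<comment> \<open>The point \<open>x (\<sigma> j)\<close> is an endpoint, hence never strictly
      between.\<close>
    have "{i \<in> S. u \<in> between i j} \<subseteq> {i \<in> S'. u \<in> between i j} \<union> \<sigma> ` ({1..k} - {j})"
      by (auto simp: S'_def between_def open_segment_real_iff)
    then have "card {i \<in> S. u \<in> between i j}
        \<le> card ({i \<in> S'. u \<in> between i j} \<union> \<sigma> ` ({1..k} - {j}))"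
      by (intro card_mono) (use fin in \<open>auto simp: S'_def\<close>)
    also have "\<dots> \<le> card {i \<in> S'. u \<in> between i j} + card (\<sigma> ` ({1..k} - {j}))"
      by (rule card_Un_le)
    also have "card (\<sigma> ` ({1..k} - {j})) = k - 1"
      using inj j by (simp add: card_image inj_on_subset)
    finally show "c \<le> real (card {i \<in> S'. u \<in> between i j})"
      using \<open>u \<in> E j\<close> assms(2) by (simp add: E_def c_def)
  qed (use fin in \<open>auto simp: S'_def\<close>)

  \<comment> \<open>Weights decrease with rank, so replacing \<open>J\<close> by the ranks
    \<open>k+1..m\<close> can only increase the sum.\<close>
  have "antimono_on {k + 1..n} (w \<circ> \<sigma>)"
  proof (rule monotone_onI)
    fix i i' assume i: "i \<in> {k + 1..n}" "i' \<in> {k + 1..n}" "i \<le> i'"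
    have *: "norm (q - x (\<sigma> i)) \<le> norm (q - x (\<sigma> i'))"
      using i by (intro mono_onD[OF mono]) auto
    \<comment> \<open>A zero denominator at rank \<open>i > k\<close> would break monotonicity, but
      then the \<open>k\<close> nearest points also equal \<open>q\<close> and all weights
      vanish.\<close>
    have "D = 0" if "q = x (\<sigma> i)"
    proof -
      have "norm (q - x (\<sigma> j)) \<le> norm (q - x (\<sigma> i))" if "j \<in> {1..k}" for j
        using i that by (intro mono_onD[OF mono]) auto
      then show ?thesis
        using that by (simp add: D_def)
    qed
    moreover have "0 \<le> D"
      by (simp add: D_def sum_nonneg)
    ultimately show "(w \<circ> \<sigma>) i' \<le> (w \<circ> \<sigma>) i"
      using * by (cases "q = x (\<sigma> i)") (auto simp: w_def intro!: divide_left_mono mult_pos_pos)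
  qed
  then have "(\<Sum>l\<in>J. (w \<circ> \<sigma>) l) \<le> (\<Sum>l=k+1..<k+1+card J. (w \<circ> \<sigma>) l)"
    using J(1) by (rule sum_le_sum_initial_segment)
  also have "{k+1..<k+1+card J} = {k+1..m}"
    using km card_J by auto
  finally have sum_w: "(\<Sum>i\<in>S'. w i) \<le> (\<Sum>l=k+1..m. w (\<sigma> l))"
    using inj by (simp add: J(2) sum.reindex inj_on_subset)

  have event_eq: "{u \<in> space uniform_sphere. \<exists>j\<in>{1..k}.
      \<alpha> * real (card S) \<le> real (card {i \<in> S. x i \<bullet> u \<in> open_segment (x (\<sigma> j) \<bullet> u) (q \<bullet> u)})}
    = (\<Union>j\<in>{1..k}. E j)"
    by (auto simp: E_def between_def m_def)
  \<comment> \<open>The factor \<open>c\<close> is kept so that the Markov bounds apply termwise; it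
    is cancelled at the end.\<close>
  have "c * prob (\<Union>j\<in>{1..k}. E j) \<le> c * (\<Sum>j=1..k. prob (E j))"
    using c by (intro mult_left_mono finite_measure_subadditive_finite) auto
  also have "\<dots> = (\<Sum>j=1..k. c * prob (E j))"
    by (rule sum_distrib_left)
  also have "\<dots> \<le> (\<Sum>j=1..k. \<Sum>i\<in>S'. prob (between i j))"
    by (intro sum_mono prob_E)
  also have "\<dots> \<le> (\<Sum>j=1..k. \<Sum>i\<in>S'. norm (q - x (\<sigma> j)) / (2 * norm (q - x i)))"
    by (intro sum_mono prob_between)
  \<comment> \<open>Summing over \<open>j\<close> first assembles \<open>D\<close>, the numerator of
    each weight.\<close>
  also have "\<dots> = (\<Sum>i\<in>S'. \<Sum>j=1..k. norm (q - x (\<sigma> j)) / (2 * norm (q - x i)))"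
    by (rule sum.swap)
  also have "\<dots> = (\<Sum>i\<in>S'. w i) / 2"
    by (simp add: w_def D_def sum_divide_distrib mult.commute)
  also have "\<dots> \<le> (\<Sum>l=k+1..m. w (\<sigma> l)) / 2"
    using sum_w by simp
  also have "\<dots> = c * (real k / (2 * (\<alpha> - (real k - 1) / real m)) * Phi k m q (x \<circ> \<sigma>))"
  proof -
    have "Phi k m q (x \<circ> \<sigma>) = (\<Sum>l=k+1..m. w (\<sigma> l)) / (real k * real m)"
      by (simp add: Phi_def w_def D_def sum_divide_distrib sum_distrib_left mult_ac)
    moreover have "\<alpha> - (real k - 1) / real m = c / real m"
      using km assms(2) by (simp add: c_def diff_divide_distrib)
    ultimately show ?thesis
      using c km assms(2) by (simp add: divide_simps mult_ac)
  qed
  finally show ?thesis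
    unfolding event_eq by (simp only: m_def mult_le_cancel_left_pos[OF c])
qed

end
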